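(* Consider the stochastic approximation recursion $w_{k+1}=w_k+\gamma_{k+1}H(w_k,X_{k+1})$, $k\ge 0$, with filtration $(\mathcal F_k)$ described in the context. Assume the following. (A) (Oracle.) $\mathbb E[\|H(w_k,X_{k+1})\|^2]<\infty$ for all $k\ge0$, and there are constants $c_{h,0},c_{h,1},\tau_0,\tau_1,\sigma_0^2,\sigma_1^2\in\mathbb R_+$ such that $\|h(w)\|^2\le c_{h,0}+c_{h,1}W(w)$ for all $w\in\mathbb R^d$ and, for every $k\ge 0$, almost surely, $$\|\mathbb E[H(w_k,X_{k+1})\mid\mathcal F_k]-h(w_k)\|^2\le\tau_0+\tau_1W(w_k),$$ $$\mathbb E\big[\|H(w_k,X_{k+1})-\mathbb E[H(w_k,X_{k+1})\mid\mathcal F_k]\|^2\mid\mathcal F_k\big]\le\sigma_0^2+\sigma_1^2W(w_k).$$ (B) (Lyapunov function.) There is a continuously differentiable $V:\mathbb R^d\to\mathbb R$ with $V_\star:=\inf V>-\infty$, with $\nabla V$ being $L_V$-Lipschitz, and there is $\rho>0$ with $\langle\nabla V(w),h(w)\rangle\le-\rho W(w)$ for all $w\in\mathbb R^d$. (C) (Small bias.) $c_V(\sqrt{\tau_0}/2+\sqrt{\tau_1})<\rho$. (D) $\gamma_k\in(0,\gamma_{\max})$ for all $k\ge1$. Then for any $T\ge1$, $$\sum_{k=0}^{T-1}\frac{\gamma_{k+1}\omega_{k+1}}{\sum_{\ell=0}^{T-1}\gamma_{\ell+1}\omega_{\ell+1}}\mathbb E[W(w_k)]\le\frac{2(\mathbb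 E[V(w_0)]-V_\star)+L_V\eta_0\sum_{k=0}^{T-1}\gamma_{k+1}^2}{\sum_{\ell=0}^{T-1}\gamma_{\ell+1}\omega_{\ell+1}}+\frac{2b_0\sum_{k=0}^{T-1}\gamma_{k+1}}{\sum_{\ell=0}^{T-1}\gamma_{\ell+1}\omega_{\ell+1}}.$$
   Context: $h:\mathbb R^d\to\mathbb R^d$ (mean field), $H:\mathbb R^d\times\mathsf X\to\mathbb R^d$ (stochastic oracle) and $W:\mathbb R^d\to\mathbb R_+$ are Borel functions; $(X_k)_{k\ge1}$ are $\mathsf X$-valued random variables; $w_0$ is an $\mathbb R^d$-valued random variable; $\gamma_k>0$ are deterministic step sizes. $\mathcal F_k:=\sigma(w_0,X_1,\dots,X_k)$. $c_V\in(0,+\infty]$ is a constant such that $\|\nabla V(w)\|\le c_V\sqrt{W(w)}$ for all $w\in\mathbb R^d$; $c_V=+\infty$ is allowed and means that no such bound is required. Conventions: $0\cdot\infty=0$, $0^{-1}=\infty$. Constants: $b_0:=c_V\sqrt{\tau_0}/2$, $\ b_1:=c_V(\sqrt{\tau_0}/2+\sqrt{\tau_1})$; for $\ell\in\{0,1\}$, $\eta_\ell:=\sigma_\ell^2+\tau_\ell+c_{h,\ell}+\sqrt{c_{h,\ell}}(\sqrt{\tau_0}+\sqrt{\tau_1})+\sqrt{\tau_\ell}(\sqrt{c_{h,0}}+\sqrt{c_{h,1}})$; $\gamma_{\max}:=2(\rho-b_1)/(L_V\eta_1)$ (equal to $+\infty$ if $\eta_1=0$); $\omega_k:=2(\rho-b_1)-\gamma_kL_V\eta_1$.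 *)

theory Defs
  imports "HOL-Probability.Probability"
begin

(* sigma(w0, X 1, ..., X k), as a sigma-algebra on the space of M *)
definition history ::
  "'p measure \<Rightarrow> 'x measure \<Rightarrow> ('p \<Rightarrow> real^'d) \<Rightarrow> (nat \<Rightarrow> 'p \<Rightarrow> 'x) \<Rightarrow> nat \<Rightarrow> 'p measure" where
  "history M N w0 X k = sigma (space M)
     ({w0 -` A \<inter> space M | A. A \<in> sets borel} \<union>
      (\<Union>i\<in>{1..k}. {X i -` A \<inter> space M | A. A \<in> sets N}))"

(* The library only has conditional expectations of scalar functions. *)
definition vec_cond_exp ::
  "'p measure \<Rightarrow> 'p measure \<Rightarrow> ('p \<Rightarrow> real^'d) \<Rightarrow> 'p \<Rightarrow> real^'d" where
  "vec_cond_exp M F f p = (\<chi> i. real_cond_exp M F (\<lambda>q. f q $ i) p)"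

(* Expectation with values in the extended reals, so that a function bounded below that is
   not integrable has expectation \<infinity>; the Bochner integral would return 0. *)
definition ext_expectation :: "'p measure \<Rightarrow> ('p \<Rightarrow> real) \<Rightarrow> ereal" where
  "ext_expectation M f =
     enn2ereal (\<integral>\<^sup>+p. ennreal (f p) \<partial>M) - enn2ereal (\<integral>\<^sup>+p. ennreal (- f p) \<partial>M)"

(* c_V may be \<infinity>, so the constants built from it are extended reals. On ereal, 0 * \<infinity> = 0
   and inverse 0 = \<infinity>, so in particular gamma_max = \<infinity> when L * eta = 0 and b1 < \<rho>.
   The arguments \<sigma>, \<tau> and c carry the paired constants at the indices 0 and 1. *)
definition b0 :: "ereal \<Rightarrow> (nat \<Rightarrow> real) \<Rightarrow> ereal" where
  "b0 cV \<tau> = cV * ereal (sqrt (\<tau> 0) / 2)"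

definition b1 :: "ereal \<Rightarrow> (nat \<Rightarrow> real) \<Rightarrow> ereal" where
  "b1 cV \<tau> = cV * ereal (sqrt (\<tau> 0) / 2 + sqrt (\<tau> 1))"

definition eta :: "(nat \<Rightarrow> real) \<Rightarrow> (nat \<Rightarrow> real) \<Rightarrow> (nat \<Rightarrow> real) \<Rightarrow> nat \<Rightarrow> real" where
  "eta \<sigma> \<tau> c l = (\<sigma> l)\<^sup>2 + \<tau> l + c l
     + sqrt (c l) * (sqrt (\<tau> 0) + sqrt (\<tau> 1))
     + sqrt (\<tau> l) * (sqrt (c 0) + sqrt (c 1))"

definition gamma_max ::
  "ereal \<Rightarrow> real \<Rightarrow> real \<Rightarrow> (nat \<Rightarrow> real) \<Rightarrow> (nat \<Rightarrow> real) \<Rightarrow> (nat \<Rightarrow> real) \<Rightarrow> ereal" where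
  "gamma_max cV \<rho> L \<sigma> \<tau> c = 2 * (ereal \<rho> - b1 cV \<tau>) / ereal (L * eta \<sigma> \<tau> c 1)"

definition omega ::
  "ereal \<Rightarrow> real \<Rightarrow> real \<Rightarrow> (nat \<Rightarrow> real) \<Rightarrow> (nat \<Rightarrow> real) \<Rightarrow> (nat \<Rightarrow> real) \<Rightarrow>
   (nat \<Rightarrow> real) \<Rightarrow> nat \<Rightarrow> ereal" where
  "omega cV \<rho> L \<sigma> \<tau> c \<gamma> k =
     2 * (ereal \<rho> - b1 cV \<tau>) - ereal (\<gamma> k * L * eta \<sigma> \<tau> c 1)"

end

theory Submission
  imports Defs
begin

text \<open>
  Write \<open>V\<^sub>k = V (w k)\<close>, \<open>W\<^sub>k = W (w k)\<close>, let \<open>G\<close> be the oracle value used in step \<open>k + 1\<close> and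
  \<open>m\<close> its conditional mean given the past. Since the gradient of \<open>V\<close> is \<open>L\<close>-Lipschitz,
  one step satisfies \<open>V\<^sub>k\<^sub>+\<^sub>1 \<le> V\<^sub>k + \<gamma> \<nabla>V \<bullet> G + L \<gamma>\<^sup>2 |G|\<^sup>2 / 2\<close> (\<open>descent_inequality\<close>).
  In expectation, \<open>G\<close> may be replaced by \<open>m\<close> in the linear term, because the gradient at
  \<open>w k\<close> is known to the past. There \<open>m\<close> is the mean field plus a bias: the mean field
  contributes \<open>- \<rho> W\<^sub>k\<close>, and the bias costs at most \<open>b0 + b1 W\<^sub>k\<close>
  (\<open>small_bias_constants\<close>). The quadratic term splits orthogonally into conditional
  variance and \<open>|m|\<^sup>2\<close> (\<open>second_moment_le_conditional\<close>), which together are at most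
  \<open>eta 0 + eta 1 W\<^sub>k\<close> (\<open>conditional_mean_squared_le\<close>). Hence
  \<open>\<gamma> \<omega> E[W\<^sub>k] \<le> 2 (E[V\<^sub>k] - E[V\<^sub>k\<^sub>+\<^sub>1]) + L eta 0 \<gamma>\<^sup>2 + 2 b0 \<gamma>\<close> (\<open>expected_descent\<close>), and the
  theorem follows by summing over \<open>k\<close> and bounding the last expectation below by \<open>inf V\<close>.

  These expectations must be finite for the argument to make sense, and only the square
  integrability of the oracle is given. Integrability of \<open>V\<^sub>k\<close> provides the rest: a function that
  is smooth and bounded below satisfies \<open>|\<nabla>V|\<^sup>2 \<le> 2 (L + 1) (V - inf V)\<close>
  (\<open>gradient_squared_le_gap\<close>), so the gradient is square integrable; the drift and growth
  conditions then bound \<open>W\<^sub>k\<close> by the gradient (\<open>lyapunov_weight_le_gradient\<close>), so \<open>W\<^sub>k\<close> is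
  integrable; and the descent inequality makes \<open>V\<^sub>k\<^sub>+\<^sub>1\<close> integrable in turn. If the initial
  \<open>V\<^sub>0\<close> is not integrable, its expectation is \<open>\<infinity>\<close>, because \<open>V\<close> is bounded below, and the
  right-hand side of the claim is \<open>\<infinity>\<close>.
\<close>

section \<open>Smooth Lyapunov functions\<close>

lemma borel_measurable_if_gradient:
  fixes V :: "'a::euclidean_space \<Rightarrow> real"
  assumes "\<And>u. GDERIV V u :> g u"
  shows "V \<in> borel_measurable borel"
proof (rule borel_measurable_continuous_onI)
  have "continuous (at u) V" for u
    using assms[of u] unfolding gderiv_def by (rule has_derivative_continuous)
  then show "continuous_on UNIV V" by (simp add: continuous_at_imp_continuous_on)
qed

text \<open>
  Along the segment from \<open>x\<close> to \<open>x + d\<close>, the difference between \<open>V\<close> and the quadratic upper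
  model has a nonpositive derivative.
\<close>

lemma descent_inequality:
  fixes V :: "'a::real_inner \<Rightarrow> real" and g :: "'a \<Rightarrow> 'a"
  assumes grad: "\<And>u. GDERIV V u :> g u" and lip: "L-lipschitz_on UNIV g"
  shows "V (x + d) \<le> V x + g x \<bullet> d + L / 2 * (norm d)\<^sup>2"
proof -
  define \<phi> where "\<phi> t = V (x + t *\<^sub>R d) - t * (g x \<bullet> d) - L / 2 * t\<^sup>2 * (norm d)\<^sup>2" for t
  have der: "(\<phi> has_real_derivative
      ((g (x + t *\<^sub>R d) - g x) \<bullet> d - L * t * (norm d)\<^sup>2)) (at t)" for t
  proof -
    have "(V has_derivative (\<lambda>h. h \<bullet> g (x + t *\<^sub>R d))) (at (x + t *\<^sub>R d))"
      using grad[of "x + t *\<^sub>R d"] by (simp add: gderiv_def)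
    moreover have "((\<lambda>t. x + t *\<^sub>R d) has_derivative (\<lambda>s. s *\<^sub>R d)) (at t)"
      by (auto intro!: derivative_eq_intros)
    ultimately have "((\<lambda>t. V (x + t *\<^sub>R d)) has_derivative
        (\<lambda>s. (s *\<^sub>R d) \<bullet> g (x + t *\<^sub>R d))) (at t)"
      by (rule has_derivative_compose[rotated])
    then have 1: "((\<lambda>t. V (x + t *\<^sub>R d)) has_real_derivative (g (x + t *\<^sub>R d) \<bullet> d)) (at t)"
      by (simp add: has_field_derivative_def inner_commute mult_commute_abs)
    show ?thesis unfolding \<phi>_def
      by (auto intro!: derivative_eq_intros 1 simp: inner_diff_left)
  qed
  have "\<phi> 1 \<le> \<phi> 0"
  proof (rule DERIV_nonpos_imp_nonincreasing[where f = \<phi> and a = 0 and b = 1])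
    fix t :: real assume t: "0 \<le> t" "t \<le> 1"
    have "(g (x + t *\<^sub>R d) - g x) \<bullet> d \<le> norm (g (x + t *\<^sub>R d) - g x) * norm d"
      by (rule norm_cauchy_schwarz)
    also have "\<dots> \<le> (L * norm (t *\<^sub>R d)) * norm d"
      using lipschitz_onD[OF lip, of "x + t *\<^sub>R d" x]
      by (intro mult_right_mono) (auto simp: dist_norm)
    also have "\<dots> = L * t * (norm d)\<^sup>2"
      using t by (simp add: power2_eq_square)
    finally show "\<exists>y. (\<phi> has_real_derivative y) (at t) \<and> y \<le> 0"
      using der[of t] by force
  qed simp
  then show ?thesis by (simp add: \<phi>_def)
qed

text \<open>
  A gradient step with step size \<open>1 / (L + 1)\<close> lowers \<open>V\<close> by at least half that step size times
  \<open>|g|\<^sup>2\<close>, yet it cannot go below the lower bound. The constant \<open>L + 1\<close> instead of the sharp \<open>L\<close>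
  covers \<open>L = 0\<close>; only finiteness of the expectation of \<open>|g|\<^sup>2\<close> is drawn from it.
\<close>

lemma gradient_squared_le_gap:
  fixes V :: "'a::real_inner \<Rightarrow> real" and g :: "'a \<Rightarrow> 'a"
  assumes grad: "\<And>u. GDERIV V u :> g u" and lip: "L-lipschitz_on UNIV g"
    and lower: "\<And>u. v \<le> V u"
  shows "(norm (g x))\<^sup>2 \<le> 2 * (L + 1) * (V x - v)"
proof -
  have L: "0 \<le> L" using lip by (rule lipschitz_on_nonneg)
  define t where "t = 1 / (L + 1)"
  have t: "t > 0" "L * t \<le> 1" "t * (L + 1) = 1" using L by (auto simp: t_def field_simps)
  have "v \<le> V (x + (- t) *\<^sub>R g x)" by (rule lower)
  also have "\<dots> \<le> V x + g x \<bullet> ((- t) *\<^sub>R g x) + L / 2 * (norm ((- t) *\<^sub>R g x))\<^sup>2"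
    by (rule descent_inequality[OF grad lip])
  also have "\<dots> = V x - t * (norm (g x))\<^sup>2 + (L * t) * (t / 2 * (norm (g x))\<^sup>2)"
    using t by (simp add: power_mult_distrib power2_norm_eq_inner) (simp add: power2_eq_square)
  also have "\<dots> \<le> V x - t * (norm (g x))\<^sup>2 + 1 * (t / 2 * (norm (g x))\<^sup>2)"
    using t by (intro add_mono mult_right_mono) auto
  finally have "t * (norm (g x))\<^sup>2 \<le> 2 * (V x - v)" by simp
  then have "(L + 1) * (t * (norm (g x))\<^sup>2) \<le> (L + 1) * (2 * (V x - v))"
    using L by (intro mult_left_mono) auto
  moreover have "(L + 1) * (t * (norm (g x))\<^sup>2) = (norm (g x))\<^sup>2"
    using t(3) by (metis mult.assoc mult.commute mult.left_neutral)
  ultimately show ?thesis by (simp only: ac_simps)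
qed

section \<open>Pointwise bounds on the oracle\<close>

lemma norm_le_sqrt_affine:
  fixes W c0 c1 :: real
  assumes "(norm x)\<^sup>2 \<le> c0 + c1 * W" "0 \<le> c0" "0 \<le> c1" "0 \<le> W"
  shows "norm x \<le> sqrt c0 + sqrt c1 * sqrt W"
proof -
  have "norm x \<le> sqrt (c0 + c1 * W)"
    using assms(1) by (rule real_le_rsqrt)
  also have "\<dots> \<le> sqrt c0 + sqrt (c1 * W)"
    using assms by (intro sqrt_add_le_add_sqrt) auto
  finally show ?thesis by (simp add: real_sqrt_mult)
qed

lemma two_sqrt_le: "0 \<le> (x::real) \<Longrightarrow> 2 * sqrt x \<le> 1 + x"
  using arith_geo_mean_sqrt[of 1 x] by simp

text \<open>
  Makes \<open>W\<close> integrable along the iterates. The drift condition and Cauchy-Schwarz give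
  \<open>\<rho> W \<le> |g| |y|\<close>, and \<open>|y|\<close> grows only like the square root of \<open>W\<close>.
\<close>

lemma lyapunov_weight_le_gradient:
  fixes g y :: "'a::real_inner"
  assumes drift: "g \<bullet> y \<le> - \<rho> * W" and growth: "(norm y)\<^sup>2 \<le> c0 + c1 * W"
    and "0 < \<rho>" "0 \<le> c0" "0 \<le> c1" "0 \<le> W"
  shows "W \<le> (2 / \<rho>) * (sqrt c0 * norm g + c1 / (2 * \<rho>) * (norm g)\<^sup>2)"
proof -
  have "\<rho> * W \<le> - (g \<bullet> y)" using drift by simp
  also have "\<dots> \<le> norm g * norm y"
    using Cauchy_Schwarz_ineq2[of g y] by linarith
  also have "\<dots> \<le> norm g * (sqrt c0 + sqrt c1 * sqrt W)"
    using norm_le_sqrt_affine[OF growth] assms by (intro mult_left_mono) auto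
  finally have 1: "\<rho> * W \<le> norm g * sqrt c0 + norm g * sqrt c1 * sqrt W"
    by (simp add: algebra_simps)
  \<comment> \<open>Young's inequality, scaled so that half of \<open>\<rho> * W\<close> absorbs the term in \<open>sqrt W\<close>.\<close>
  have "0 \<le> (sqrt c1 * norm g - \<rho> * sqrt W)\<^sup>2" by simp
  also have "\<dots> = c1 * (norm g)\<^sup>2 + \<rho> * (\<rho> * W) - 2 * \<rho> * (norm g * sqrt c1 * sqrt W)"
    using assms by (simp add: power2_diff power_mult_distrib) (simp add: power2_eq_square)
  finally have "2 * \<rho> * (norm g * sqrt c1 * sqrt W) \<le> c1 * (norm g)\<^sup>2 + \<rho> * (\<rho> * W)"
    by simp
  then have "norm g * sqrt c1 * sqrt W \<le> c1 / (2 * \<rho>) * (norm g)\<^sup>2 + \<rho> * W / 2"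
    using \<open>0 < \<rho>\<close> by (simp add: field_simps power2_eq_square)
  with 1 have "\<rho> * W \<le> 2 * (sqrt c0 * norm g + c1 / (2 * \<rho>) * (norm g)\<^sup>2)"
    by (simp add: mult.commute)
  then show ?thesis using \<open>0 < \<rho>\<close> by (simp add: field_simps)
qed

text \<open>
  This is where the constants \<open>eta\<close> come from. Expanding \<open>|y + (m - y)|\<^sup>2\<close> leaves a cross term
  of two square roots; each is split by subadditivity, and \<open>2 sqrt W \<le> 1 + W\<close> distributes the
  mixed products evenly over \<open>eta 0\<close> and \<open>eta 1\<close>.
\<close>

lemma conditional_mean_squared_le:
  fixes m y :: "'a::real_inner" and \<tau> c :: "nat \<Rightarrow> real"
  assumes bias: "(norm (m - y))\<^sup>2 \<le> \<tau> 0 + \<tau> 1 * W" and growth: "(norm y)\<^sup>2 \<le> c 0 + c 1 * W"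
    and "0 \<le> c 0" "0 \<le> c 1" "0 \<le> \<tau> 0" "0 \<le> \<tau> 1" "0 \<le> W"
  shows "(norm m)\<^sup>2 + ((\<sigma> 0)\<^sup>2 + (\<sigma> 1)\<^sup>2 * W) \<le> eta \<sigma> \<tau> c 0 + eta \<sigma> \<tau> c 1 * W"
proof -
  let ?k = "sqrt (c 0) * sqrt (\<tau> 1) + sqrt (c 1) * sqrt (\<tau> 0)"
  have "y \<bullet> (m - y) \<le> norm y * norm (m - y)" by (rule norm_cauchy_schwarz)
  also have "\<dots> \<le> (sqrt (c 0) + sqrt (c 1) * sqrt W) * (sqrt (\<tau> 0) + sqrt (\<tau> 1) * sqrt W)"
    using assms norm_le_sqrt_affine[OF bias] norm_le_sqrt_affine[OF growth]
    by (intro mult_mono) auto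
  also have "\<dots> = sqrt (c 0) * sqrt (\<tau> 0) + ?k * sqrt W
      + sqrt (c 1) * sqrt (\<tau> 1) * (sqrt W * sqrt W)"
    by (simp only: algebra_simps)
  finally have 1: "2 * (y \<bullet> (m - y)) \<le> 2 * (sqrt (c 0) * sqrt (\<tau> 0)) + ?k * (2 * sqrt W)
      + 2 * (sqrt (c 1) * sqrt (\<tau> 1)) * W"
    using assms by (simp add: algebra_simps)
  have 2: "?k * (2 * sqrt W) \<le> ?k * (1 + W)"
    using assms by (intro mult_left_mono two_sqrt_le) auto
  have "(norm m)\<^sup>2 = (norm y)\<^sup>2 + 2 * (y \<bullet> (m - y)) + (norm (m - y))\<^sup>2"
    by (simp add: power2_norm_eq_inner inner_diff_left inner_diff_right inner_commute)
  also have "\<dots> \<le> (c 0 + c 1 * W) + (2 * (sqrt (c 0) * sqrt (\<tau> 0)) + ?k * (1 + W)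
      + 2 * (sqrt (c 1) * sqrt (\<tau> 1)) * W) + (\<tau> 0 + \<tau> 1 * W)"
    using 1 2 assms by linarith
  finally show ?thesis
    by (simp add: eta_def algebra_simps)
qed

text \<open>
  This is where the gradient bound with constant \<open>cV\<close> enters. If \<open>cV\<close> is finite, the product of \<open>cV sqrt W\<close> and
  \<open>sqrt \<tau>\<^sub>0 + sqrt \<tau>\<^sub>1 sqrt W\<close> is made affine in \<open>W\<close> by \<open>2 sqrt W \<le> 1 + W\<close>. If it is infinite,
  the small bias condition leaves no room for a bias: both \<open>\<tau>\<close> vanish, and so do \<open>b0\<close> and \<open>b1\<close>.
  Either way the constants are real, so that the estimates can be made over the reals.
\<close>

lemma small_bias_constants:
  fixes gradV :: "'a::real_inner \<Rightarrow> 'a" and W :: "'a \<Rightarrow> real" and \<tau> :: "nat \<Rightarrow> real"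
  assumes "0 < cV" and \<tau>: "0 \<le> \<tau> 0" "0 \<le> \<tau> 1" and W: "\<And>u. 0 \<le> W u"
    and cV_bound: "cV = \<infinity> \<or> (\<forall>u. ereal (norm (gradV u)) \<le> cV * ereal (sqrt (W u)))"
    and small_bias: "cV * ereal (sqrt (\<tau> 0) / 2 + sqrt (\<tau> 1)) < ereal \<rho>"
  obtains B0 B1 where "b0 cV \<tau> = ereal B0" "b1 cV \<tau> = ereal B1" "B1 < \<rho>"
    "\<And>u e. (norm e)\<^sup>2 \<le> \<tau> 0 + \<tau> 1 * W u \<Longrightarrow> gradV u \<bullet> e \<le> B0 + B1 * W u"
proof (cases cV)
  case (real r)
  let ?B0 = "r * (sqrt (\<tau> 0) / 2)" and ?B1 = "r * (sqrt (\<tau> 0) / 2 + sqrt (\<tau> 1))"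
  have r: "0 < r" using real \<open>0 < cV\<close> by simp
  have "gradV u \<bullet> e \<le> ?B0 + ?B1 * W u" if e: "(norm e)\<^sup>2 \<le> \<tau> 0 + \<tau> 1 * W u" for u e
  proof -
    have "gradV u \<bullet> e \<le> norm (gradV u) * norm e" by (rule norm_cauchy_schwarz)
    also have "\<dots> \<le> (r * sqrt (W u)) * (sqrt (\<tau> 0) + sqrt (\<tau> 1) * sqrt (W u))"
      using cV_bound real r W[of u] \<tau> norm_le_sqrt_affine[OF e]
      by (intro mult_mono) auto
    also have "\<dots> = r * (sqrt (\<tau> 0) / 2 * (2 * sqrt (W u)) + sqrt (\<tau> 1) * (sqrt (W u) * sqrt (W u)))"
      by (simp only: algebra_simps)
    also have "\<dots> \<le> r * (sqrt (\<tau> 0) / 2 * (1 + W u) + sqrt (\<tau> 1) * W u)"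
      using r \<tau> W[of u] two_sqrt_le[of "W u"]
      by (intro mult_left_mono add_mono) auto
    finally show ?thesis by (simp add: algebra_simps add_divide_distrib)
  qed
  then show ?thesis
    using that[of ?B0 ?B1] small_bias real by (simp add: b0_def b1_def)
next
  case PInf
  have "sqrt (\<tau> 0) / 2 + sqrt (\<tau> 1) = 0"
  proof (rule ccontr)
    assume "sqrt (\<tau> 0) / 2 + sqrt (\<tau> 1) \<noteq> 0"
    moreover have "0 \<le> sqrt (\<tau> 0) / 2 + sqrt (\<tau> 1)" using \<tau> by simp
    ultimately have "0 < sqrt (\<tau> 0) / 2 + sqrt (\<tau> 1)" by linarith
    then show False using small_bias PInf by simp
  qed
  then have z: "\<tau> 0 = 0" "\<tau> 1 = 0"
    using \<tau> real_sqrt_ge_zero[OF \<tau>(1)] real_sqrt_ge_zero[OF \<tau>(2)]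
    by (simp_all add: add_nonneg_eq_0_iff)
  show ?thesis
    using that[of 0 0] small_bias z by (simp add: b0_def b1_def zero_ereal_def[symmetric])
next
  case MInf
  then show ?thesis using \<open>0 < cV\<close> by simp
qed

section \<open>Square-integrable vectors and conditional expectation\<close>

lemma integrable_inner_L2:
  fixes f g :: "'p \<Rightarrow> 'a::euclidean_space"
  assumes [measurable]: "f \<in> borel_measurable M" "g \<in> borel_measurable M"
    and "integrable M (\<lambda>p. (norm (f p))\<^sup>2)" "integrable M (\<lambda>p. (norm (g p))\<^sup>2)"
  shows "integrable M (\<lambda>p. f p \<bullet> g p)"
proof (rule Bochner_Integration.integrable_bound)
  show "integrable M (\<lambda>p. (norm (f p))\<^sup>2 + (norm (g p))\<^sup>2)" using assms by auto
  have "norm (f p \<bullet> g p) \<le> norm ((norm (f p))\<^sup>2 + (norm (g p))\<^sup>2)" for p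
  proof -
    have "norm (f p \<bullet> g p) \<le> norm (f p) * norm (g p)"
      using Cauchy_Schwarz_ineq2 by auto
    also have "\<dots> \<le> (norm (f p))\<^sup>2 + (norm (g p))\<^sup>2"
      using sum_squares_bound[of "norm (f p)" "norm (g p)"] mult_nonneg_nonneg[OF norm_ge_zero norm_ge_zero, of "f p" "g p"]
      unfolding mult.assoc by linarith
    finally show ?thesis by simp
  qed
  then show "AE p in M. norm (f p \<bullet> g p) \<le> norm ((norm (f p))\<^sup>2 + (norm (g p))\<^sup>2)" by simp
qed measurable

lemma borel_measurable_vec_lambda:
  assumes "\<And>i. (\<lambda>p. f i p) \<in> borel_measurable F"
  shows "(\<lambda>p. (\<chi> i. f i p) :: real^'d) \<in> borel_measurable F"
proof (subst borel_measurable_euclidean_space, intro ballI)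
  fix b :: "real^'d" assume "b \<in> Basis"
  then obtain i where "b = axis i 1" by (auto simp: Basis_vec_def)
  then show "(\<lambda>p. (\<chi> i. f i p) \<bullet> b) \<in> borel_measurable F"
    using assms[of i] by (simp add: inner_axis)
qed

lemma borel_measurable_vec_cond_exp:
  "vec_cond_exp M F G \<in> borel_measurable F"
  unfolding vec_cond_exp_def[abs_def] by (intro borel_measurable_vec_lambda) simp

lemma borel_measurable_vec_component:
  fixes f :: "'p \<Rightarrow> real^'d"
  assumes "f \<in> borel_measurable F" shows "(\<lambda>p. f p $ i) \<in> borel_measurable F"
  using assms by (simp add: cart_eq_inner_axis)

text \<open>
  The defining property of conditional expectation, summed over the coordinates. Square
  integrability of both factors supplies the integrability of each product of coordinates.
\<close>

lemma (in sigma_finite_subalgebra) integral_inner_vec_cond_exp: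
  fixes f G :: "'a \<Rightarrow> real^'d"
  assumes f: "f \<in> borel_measurable F" "integrable M (\<lambda>p. (norm (f p))\<^sup>2)"
    and G: "G \<in> borel_measurable M" "integrable M (\<lambda>p. (norm (G p))\<^sup>2)"
  shows "integrable M (\<lambda>p. f p \<bullet> vec_cond_exp M F G p)"
    and "(\<integral>p. f p \<bullet> vec_cond_exp M F G p \<partial>M) = (\<integral>p. f p \<bullet> G p \<partial>M)"
proof -
  have fM: "f \<in> borel_measurable M" using f(1) subalg by (rule measurable_from_subalg[rotated])
  have int: "integrable M (\<lambda>p. f p $ i * G p $ i)" for i
  proof (rule Bochner_Integration.integrable_bound)
    show "integrable M (\<lambda>p. (norm (f p))\<^sup>2 + (norm (G p))\<^sup>2)" using f G by auto
    show "(\<lambda>p. f p $ i * G p $ i) \<in> borel_measurable M"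
      using fM G(1) by (intro borel_measurable_times borel_measurable_vec_component)
    have "norm (f p $ i * G p $ i) \<le> norm ((norm (f p))\<^sup>2 + (norm (G p))\<^sup>2)" for p
    proof -
      have "norm (f p $ i * G p $ i) \<le> norm (f p) * norm (G p)"
        using component_le_norm_cart[of "f p" i] component_le_norm_cart[of "G p" i]
        by (simp add: abs_mult mult_mono)
      also have "\<dots> \<le> (norm (f p))\<^sup>2 + (norm (G p))\<^sup>2"
        using sum_squares_bound[of "norm (f p)" "norm (G p)"] mult_nonneg_nonneg[OF norm_ge_zero norm_ge_zero, of "f p" "G p"]
      unfolding mult.assoc by linarith
      finally show ?thesis by simp
    qed
    then show "AE p in M. norm (f p $ i * G p $ i) \<le> norm ((norm (f p))\<^sup>2 + (norm (G p))\<^sup>2)" by simp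
  qed
  note ce = real_cond_exp_intg[OF int borel_measurable_vec_component[OF f(1)]
      borel_measurable_vec_component[OF G(1)]]
  show "integrable M (\<lambda>p. f p \<bullet> vec_cond_exp M F G p)"
    using ce(1) by (simp add: inner_vec_def vec_cond_exp_def)
  show "(\<integral>p. f p \<bullet> vec_cond_exp M F G p \<partial>M) = (\<integral>p. f p \<bullet> G p \<partial>M)"
    using ce int by (simp add: inner_vec_def vec_cond_exp_def)
qed

text \<open>
  Pythagoras: the conditional mean is orthogonal to the deviation from it, so the second moment
  is that of the conditional mean plus the expected conditional variance.
\<close>

lemma (in sigma_finite_subalgebra) second_moment_le_conditional:
  fixes G :: "'a \<Rightarrow> real^'d"
  assumes G: "G \<in> borel_measurable M" "integrable M (\<lambda>p. (norm (G p))\<^sup>2)"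
    and m: "integrable M (\<lambda>p. (norm (vec_cond_exp M F G p))\<^sup>2)"
    and var: "AE p in M. real_cond_exp M F (\<lambda>q. (norm (G q - vec_cond_exp M F G q))\<^sup>2) p \<le> s p"
    and s: "integrable M s"
  shows "(\<integral>p. (norm (G p))\<^sup>2 \<partial>M) \<le> (\<integral>p. (norm (vec_cond_exp M F G p))\<^sup>2 + s p \<partial>M)"
proof -
  let ?m = "vec_cond_exp M F G"
  have mF: "?m \<in> borel_measurable F" by (rule borel_measurable_vec_cond_exp)
  have mM: "?m \<in> borel_measurable M" using mF subalg by (rule measurable_from_subalg[rotated])
  have i: "integrable M (\<lambda>p. ?m p \<bullet> G p)"
    by (rule integrable_inner_L2[OF mM G(1) m G(2)])
  have orth: "(\<integral>p. ?m p \<bullet> G p \<partial>M) = (\<integral>p. (norm (?m p))\<^sup>2 \<partial>M)"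
    using integral_inner_vec_cond_exp(2)[OF mF m G] by (simp add: power2_norm_eq_inner)
  have split: "(norm (G p - ?m p))\<^sup>2 = (norm (G p))\<^sup>2 - 2 * (?m p \<bullet> G p) + (norm (?m p))\<^sup>2" for p
    by (simp add: power2_norm_eq_inner inner_diff_left inner_diff_right inner_commute)
  have j: "integrable M (\<lambda>p. (norm (G p - ?m p))\<^sup>2)"
    unfolding split using i m G by auto
  have "(\<integral>p. (norm (G p))\<^sup>2 \<partial>M) - (\<integral>p. (norm (?m p))\<^sup>2 \<partial>M) = (\<integral>p. (norm (G p - ?m p))\<^sup>2 \<partial>M)"
    unfolding split using i m G by (simp add: orth)
  also have "\<dots> = (\<integral>p. real_cond_exp M F (\<lambda>q. (norm (G q - ?m q))\<^sup>2) p \<partial>M)"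
    by (rule real_cond_exp_int(2)[OF j, symmetric])
  also have "\<dots> \<le> (\<integral>p. s p \<partial>M)"
    by (rule integral_mono_AE[OF real_cond_exp_int(1)[OF j] s var])
  finally show ?thesis using m s by simp
qed

section \<open>The filtration\<close>

lemma history_generators:
  "{w0 -` A \<inter> space M | A. A \<in> sets borel} \<union>
      (\<Union>i\<in>{1..k}. {X i -` A \<inter> space M | A. A \<in> sets N}) \<subseteq> Pow (space M)"
  by auto

lemma space_history [simp]: "space (history M N w0 X k) = space M"
  unfolding history_def by (rule space_measure_of[OF history_generators])

lemma sets_history:
  "sets (history M N w0 X k) = sigma_sets (space M)
     ({w0 -` A \<inter> space M | A. A \<in> sets borel} \<union>
      (\<Union>i\<in>{1..k}. {X i -` A \<inter> space M | A. A \<in> sets N}))"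
  unfolding history_def by (rule sets_measure_of[OF history_generators])

lemma subalgebra_history:
  assumes "w0 \<in> borel_measurable M" "\<And>i. 1 \<le> i \<Longrightarrow> X i \<in> measurable M N"
  shows "subalgebra M (history M N w0 X k)"
  unfolding subalgebra_def sets_history
  using assms by (auto intro!: sets.sigma_sets_subset simp: measurable_sets)

lemma history_mono:
  "j \<le> k \<Longrightarrow> subalgebra (history M N w0 X k) (history M N w0 X j)"
  unfolding subalgebra_def sets_history space_history
  by (intro conjI refl sigma_sets_mono' Un_mono UN_mono subset_refl) auto

lemma initial_measurable_history: "w0 \<in> borel_measurable (history M N w0 X k)"
  by (rule measurableI) (auto simp: sets_history intro!: sigma_sets.Basic)

lemma observation_measurable_history:
  assumes "X i \<in> measurable M N" "i \<in> {1..k}"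
  shows "X i \<in> measurable (history M N w0 X k) N"
  using assms measurable_space[OF assms(1)]
  by (intro measurableI) (auto simp: sets_history intro!: sigma_sets.Basic)

lemma iterate_measurable_history:
  fixes H :: "(real^'d) \<times> 'x \<Rightarrow> real^'d"
  assumes H: "H \<in> borel_measurable (borel \<Otimes>\<^sub>M N)"
    and X: "\<And>i. 1 \<le> i \<Longrightarrow> X i \<in> measurable M N"
    and rec: "\<And>k p. p \<in> space M \<Longrightarrow>
          w (Suc k) p = w k p + \<gamma> (Suc k) *\<^sub>R H (w k p, X (Suc k) p)"
  shows "w k \<in> borel_measurable (history M N (w 0) X k)"
proof (induction k)
  case 0
  show ?case by (rule initial_measurable_history)
next
  case (Suc k)
  let ?F = "history M N (w 0) X (Suc k)"
  have [measurable]: "w k \<in> borel_measurable ?F"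
    by (rule measurable_from_subalg[OF history_mono Suc]) simp
  have [measurable]: "X (Suc k) \<in> measurable ?F N"
    by (rule observation_measurable_history) (use X in auto)
  note H[measurable]
  have "(\<lambda>p. w k p + \<gamma> (Suc k) *\<^sub>R H (w k p, X (Suc k) p)) \<in> borel_measurable ?F"
    by measurable
  then show ?case
    by (subst measurable_cong[where g="\<lambda>p. w k p + \<gamma> (Suc k) *\<^sub>R H (w k p, X (Suc k) p)"])
       (use rec in auto)
qed

section \<open>Extended expectations\<close>

lemma ext_expectation_integrable:
  assumes "integrable M f" shows "ext_expectation M f = ereal (\<integral>p. f p \<partial>M)"
proof -
  have "(\<integral>\<^sup>+p. ennreal (f p) \<partial>M) < \<infinity>" "(\<integral>\<^sup>+p. ennreal (- f p) \<partial>M) < \<infinity>"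
    using assms by (auto simp: real_integrable_def top.not_eq_extremum)
  then show ?thesis
    unfolding ext_expectation_def real_lebesgue_integral_def[OF assms]
    by (cases "\<integral>\<^sup>+p. ennreal (f p) \<partial>M"; cases "\<integral>\<^sup>+p. ennreal (- f p) \<partial>M") (auto simp: enn2ereal_ennreal)
qed

lemma (in finite_measure) ext_expectation_not_integrable:
  assumes f: "f \<in> borel_measurable M" "\<not> integrable M f" and lower: "\<And>p. v \<le> f p"
  shows "ext_expectation M f = \<infinity>"
proof -
  have "(\<integral>\<^sup>+p. ennreal (- f p) \<partial>M) \<le> (\<integral>\<^sup>+p. ennreal (- v) \<partial>M)"
    using lower by (intro nn_integral_mono ennreal_leI) simp
  also have "\<dots> < \<infinity>" by (simp add: ennreal_mult_less_top emeasure_eq_measure)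
  finally have neg: "(\<integral>\<^sup>+p. ennreal (- f p) \<partial>M) < \<infinity>" .
  then have "(\<integral>\<^sup>+p. ennreal (f p) \<partial>M) = \<infinity>"
    using f by (auto simp: real_integrable_def)
  then show ?thesis
    unfolding ext_expectation_def using neg
    by (cases "\<integral>\<^sup>+p. ennreal (- f p) \<partial>M") (auto simp: enn2ereal_ennreal)
qed

section \<open>Expected descent and telescoping\<close>

text \<open>
  One step of the recursion, for a past \<open>F\<close>, a current point \<open>u\<close> known to the past, an oracle
  value \<open>G\<close> and a step size \<open>a\<close>. Integrability of \<open>V\<close> is both hypothesis and conclusion, so that
  the lemma can be iterated. The effect of the bias enters only through \<open>bias_work\<close>, which keeps
  the possibly infinite \<open>cV\<close> out of the argument.
\<close>

lemma (in prob_space) expected_descent: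
  fixes u G :: "'a \<Rightarrow> real^'d" and V W :: "real^'d \<Rightarrow> real" and g h :: "real^'d \<Rightarrow> real^'d"
    and \<sigma> \<tau> c :: "nat \<Rightarrow> real" and a B0 B1 L \<rho> v :: real and F :: "'a measure"
  defines "m \<equiv> vec_cond_exp M F G"
  assumes F: "subalgebra M F"
    and u: "u \<in> borel_measurable F" and G: "G \<in> borel_measurable M" "integrable M (\<lambda>p. (norm (G p))\<^sup>2)"
    and Vu: "integrable M (\<lambda>p. V (u p))" and "0 \<le> a"
    and h [measurable]: "h \<in> borel_measurable borel"
    and W [measurable]: "W \<in> borel_measurable borel" and W0: "\<And>x. 0 \<le> W x"
    and nonneg: "0 \<le> c 0" "0 \<le> c 1" "0 \<le> \<tau> 0" "0 \<le> \<tau> 1"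
    and growth: "\<And>x. (norm (h x))\<^sup>2 \<le> c 0 + c 1 * W x"
    and bias: "AE p in M. (norm (m p - h (u p)))\<^sup>2 \<le> \<tau> 0 + \<tau> 1 * W (u p)"
    and var: "AE p in M. real_cond_exp M F (\<lambda>q. (norm (G q - m q))\<^sup>2) p \<le> (\<sigma> 0)\<^sup>2 + (\<sigma> 1)\<^sup>2 * W (u p)"
    and grad: "\<And>x. GDERIV V x :> g x" and lip: "L-lipschitz_on UNIV g" and lower: "\<And>x. v \<le> V x"
    and "0 < \<rho>" and drift: "\<And>x. g x \<bullet> h x \<le> - \<rho> * W x"
    and bias_work: "\<And>x e. (norm e)\<^sup>2 \<le> \<tau> 0 + \<tau> 1 * W x \<Longrightarrow> g x \<bullet> e \<le> B0 + B1 * W x"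
  shows "integrable M (\<lambda>p. V (u p + a *\<^sub>R G p))"
    and "integrable M (\<lambda>p. W (u p))"
    and "a * (2 * (\<rho> - B1) - a * L * eta \<sigma> \<tau> c 1) * (\<integral>p. W (u p) \<partial>M)
         \<le> 2 * ((\<integral>p. V (u p) \<partial>M) - (\<integral>p. V (u p + a *\<^sub>R G p) \<partial>M))
           + L * eta \<sigma> \<tau> c 0 * a\<^sup>2 + 2 * B0 * a"
proof -
  interpret fm: finite_measure_subalgebra M F
    using F by unfold_locales
  note [measurable] = G(1)
  have mF: "m \<in> borel_measurable F" unfolding m_def by (rule borel_measurable_vec_cond_exp)
  have [measurable]: "m \<in> borel_measurable M" "u \<in> borel_measurable M"
    using mF u F by (auto intro: measurable_from_subalg)
  have L0: "0 \<le> L" using lip by (rule lipschitz_on_nonneg)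
  note borel_measurable_if_gradient[OF grad, measurable]
  have gm [measurable]: "g \<in> borel_measurable borel"
    using lipschitz_on_continuous_on[OF lip] by (rule borel_measurable_continuous_onI)
  have guF: "(\<lambda>p. g (u p)) \<in> borel_measurable F" using u by measurable
  have g2: "integrable M (\<lambda>p. (norm (g (u p)))\<^sup>2)"
  proof (rule Bochner_Integration.integrable_bound)
    show "integrable M (\<lambda>p. 2 * (L + 1) * (V (u p) - v))" using Vu by auto
    show "AE p in M. norm ((norm (g (u p)))\<^sup>2) \<le> norm (2 * (L + 1) * (V (u p) - v))"
      using order_trans[OF gradient_squared_le_gap[OF grad lip lower] abs_ge_self]
      by (intro AE_I2) (simp add: abs_mult)
  qed measurable
  have g1: "integrable M (\<lambda>p. norm (g (u p)))"
    using square_integrable_imp_integrable[OF _ g2] by simp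
  show Wu: "integrable M (\<lambda>p. W (u p))"
  proof (rule Bochner_Integration.integrable_bound)
    show "integrable M (\<lambda>p. (2 / \<rho>) * (sqrt (c 0) * norm (g (u p)) + c 1 / (2 * \<rho>) * (norm (g (u p)))\<^sup>2))"
      using g1 g2 by auto
    show "AE p in M. norm (W (u p)) \<le>
        norm ((2 / \<rho>) * (sqrt (c 0) * norm (g (u p)) + c 1 / (2 * \<rho>) * (norm (g (u p)))\<^sup>2))"
    proof (intro AE_I2)
      fix p
      show "norm (W (u p)) \<le>
        norm ((2 / \<rho>) * (sqrt (c 0) * norm (g (u p)) + c 1 / (2 * \<rho>) * (norm (g (u p)))\<^sup>2))"
        using lyapunov_weight_le_gradient[OF drift growth \<open>0 < \<rho>\<close> nonneg(1,2) W0, of "u p"] W0[of "u p"]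
        unfolding real_norm_def by linarith
    qed
  qed measurable
  let ?e0 = "eta \<sigma> \<tau> c 0" and ?e1 = "eta \<sigma> \<tau> c 1"
  \<comment> \<open>The bound on the second moment; it also shows that the conditional mean is square integrable.\<close>
  have sq: "AE p in M. (norm (m p))\<^sup>2 + ((\<sigma> 0)\<^sup>2 + (\<sigma> 1)\<^sup>2 * W (u p)) \<le> ?e0 + ?e1 * W (u p)"
    using bias by eventually_elim (rule conditional_mean_squared_le[where y = "h (u _)", OF _ growth nonneg W0])
  have m2: "integrable M (\<lambda>p. (norm (m p))\<^sup>2)"
  proof (rule Bochner_Integration.integrable_bound)
    show "integrable M (\<lambda>p. ?e0 + ?e1 * W (u p))" using Wu by auto
    show "AE p in M. norm ((norm (m p))\<^sup>2) \<le> norm (?e0 + ?e1 * W (u p))"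
      using sq
    proof eventually_elim
      case (elim p)
      have "0 \<le> (\<sigma> 0)\<^sup>2 + (\<sigma> 1)\<^sup>2 * W (u p)" using W0 by simp
      with elim show ?case by simp
    qed
  qed measurable
  have "(\<integral>p. (norm (G p))\<^sup>2 \<partial>M) \<le> (\<integral>p. (norm (m p))\<^sup>2 + ((\<sigma> 0)\<^sup>2 + (\<sigma> 1)\<^sup>2 * W (u p)) \<partial>M)"
    using fm.second_moment_le_conditional[OF G m2[unfolded m_def] var[unfolded m_def]] Wu
    by (simp add: m_def)
  also have "\<dots> \<le> (\<integral>p. ?e0 + ?e1 * W (u p) \<partial>M)"
    using m2 Wu sq by (intro integral_mono_AE) auto
  also have "\<dots> = ?e0 + ?e1 * (\<integral>p. W (u p) \<partial>M)"
    using Wu by (simp add: prob_space)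
  finally have second: "(\<integral>p. (norm (G p))\<^sup>2 \<partial>M) \<le> ?e0 + ?e1 * (\<integral>p. W (u p) \<partial>M)" .
  have gm_int: "integrable M (\<lambda>p. g (u p) \<bullet> m p)"
    and gm_eq: "(\<integral>p. g (u p) \<bullet> m p \<partial>M) = (\<integral>p. g (u p) \<bullet> G p \<partial>M)"
    unfolding m_def by (rule fm.integral_inner_vec_cond_exp[OF guF g2 G])+
  have gG: "integrable M (\<lambda>p. g (u p) \<bullet> G p)"
    by (rule integrable_inner_L2[OF _ _ g2 G(2)]) measurable
  have "(\<integral>p. g (u p) \<bullet> m p \<partial>M) \<le> (\<integral>p. B0 - (\<rho> - B1) * W (u p) \<partial>M)"
  proof (rule integral_mono_AE[OF gm_int])
    show "integrable M (\<lambda>p. B0 - (\<rho> - B1) * W (u p))" using Wu by auto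
    show "AE p in M. g (u p) \<bullet> m p \<le> B0 - (\<rho> - B1) * W (u p)"
      using bias
    proof eventually_elim
      case (elim p)
      have "g (u p) \<bullet> m p = g (u p) \<bullet> h (u p) + g (u p) \<bullet> (m p - h (u p))"
        by (simp add: inner_diff_right)
      with drift[of "u p"] bias_work[OF elim] show ?case unfolding left_diff_distrib by linarith
    qed
  qed
  also have "\<dots> = B0 - (\<rho> - B1) * (\<integral>p. W (u p) \<partial>M)"
    using Wu by (simp add: prob_space)
  finally have first: "(\<integral>p. g (u p) \<bullet> G p \<partial>M) \<le> B0 - (\<rho> - B1) * (\<integral>p. W (u p) \<partial>M)"
    by (simp add: gm_eq)
  let ?R = "\<lambda>p. V (u p) + a * (g (u p) \<bullet> G p) + L / 2 * a\<^sup>2 * (norm (G p))\<^sup>2"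
  have R: "integrable M ?R" using Vu gG G by auto
  have step: "V (u p + a *\<^sub>R G p) \<le> ?R p" for p
    using descent_inequality[OF grad lip, of "u p" "a *\<^sub>R G p"] by (simp add: power_mult_distrib)
  show V': "integrable M (\<lambda>p. V (u p + a *\<^sub>R G p))"
  proof (rule Bochner_Integration.integrable_bound)
    show "integrable M (\<lambda>p. \<bar>?R p\<bar> + \<bar>v\<bar>)" using R by auto
    \<comment> \<open>\<open>V\<close> lies between the constant \<open>v\<close> and the integrable upper model.\<close>
    show "AE p in M. norm (V (u p + a *\<^sub>R G p)) \<le> norm (\<bar>?R p\<bar> + \<bar>v\<bar>)"
    proof (intro AE_I2)
      fix p
      show "norm (V (u p + a *\<^sub>R G p)) \<le> norm (\<bar>?R p\<bar> + \<bar>v\<bar>)"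
        using step[of p] lower[of "u p + a *\<^sub>R G p"] unfolding real_norm_def by linarith
    qed
  qed measurable
  have "(\<integral>p. V (u p + a *\<^sub>R G p) \<partial>M) \<le> (\<integral>p. ?R p \<partial>M)"
    by (rule integral_mono[OF V' R step])
  also have "\<dots> = (\<integral>p. V (u p) \<partial>M) + a * (\<integral>p. g (u p) \<bullet> G p \<partial>M)
      + L / 2 * a\<^sup>2 * (\<integral>p. (norm (G p))\<^sup>2 \<partial>M)"
    using Vu gG G by simp
  also have "\<dots> \<le> (\<integral>p. V (u p) \<partial>M) + a * (B0 - (\<rho> - B1) * (\<integral>p. W (u p) \<partial>M))
      + L / 2 * a\<^sup>2 * (?e0 + ?e1 * (\<integral>p. W (u p) \<partial>M))"
    using first second \<open>0 \<le> a\<close> L0 by (intro add_mono mult_left_mono) auto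
  finally show "a * (2 * (\<rho> - B1) - a * L * eta \<sigma> \<tau> c 1) * (\<integral>p. W (u p) \<partial>M)
         \<le> 2 * ((\<integral>p. V (u p) \<partial>M) - (\<integral>p. V (u p + a *\<^sub>R G p) \<partial>M))
           + L * eta \<sigma> \<tau> c 0 * a\<^sup>2 + 2 * B0 * a"
    by (simp add: algebra_simps power2_eq_square)
qed

theorem theorem1:
  fixes M :: "'p measure" and N :: "'x measure"
    and h gradV :: "real^'d \<Rightarrow> real^'d"
    and H :: "(real^'d) \<times> 'x \<Rightarrow> real^'d"
    and W V :: "real^'d \<Rightarrow> real"
    and X :: "nat \<Rightarrow> 'p \<Rightarrow> 'x" and w :: "nat \<Rightarrow> 'p \<Rightarrow> real^'d"
    and \<gamma> \<sigma> \<tau> c :: "nat \<Rightarrow> real"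
    and L \<rho> :: real and cV :: ereal and T :: nat
  assumes "prob_space M"
    and "h \<in> borel_measurable borel"
    and "H \<in> borel_measurable (borel \<Otimes>\<^sub>M N)"
    and "W \<in> borel_measurable borel"
    and "\<And>u. 0 \<le> W u"
    and "\<And>k. 1 \<le> k \<Longrightarrow> X k \<in> measurable M N"
    and "w 0 \<in> borel_measurable M"
    and recursion: "\<And>k p. p \<in> space M \<Longrightarrow>
          w (Suc k) p = w k p + \<gamma> (Suc k) *\<^sub>R H (w k p, X (Suc k) p)"
    and constants_nonneg: "\<And>l. l \<in> {0, 1} \<Longrightarrow> 0 \<le> c l \<and> 0 \<le> \<tau> l \<and> 0 \<le> \<sigma> l"
    and oracle_L2: "\<And>k. integrable M (\<lambda>p. (norm (H (w k p, X (Suc k) p)))\<^sup>2)"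
    and mean_field_bound: "\<And>u. (norm (h u))\<^sup>2 \<le> c 0 + c 1 * W u"
    and oracle_bias: "\<And>k. AE p in M.
          (norm (vec_cond_exp M (history M N (w 0) X k) (\<lambda>q. H (w k q, X (Suc k) q)) p
                 - h (w k p)))\<^sup>2
          \<le> \<tau> 0 + \<tau> 1 * W (w k p)"
    and oracle_variance: "\<And>k. AE p in M.
          real_cond_exp M (history M N (w 0) X k)
            (\<lambda>q. (norm (H (w k q, X (Suc k) q)
                    - vec_cond_exp M (history M N (w 0) X k)
                        (\<lambda>q'. H (w k q', X (Suc k) q')) q))\<^sup>2) p
          \<le> (\<sigma> 0)\<^sup>2 + (\<sigma> 1)\<^sup>2 * W (w k p)"
    and V_gradient: "\<And>u. GDERIV V u :> gradV u"
    and V_C1: "continuous_on UNIV gradV"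
    and V_bounded_below: "bdd_below (range V)"
    and gradV_lipschitz: "L-lipschitz_on UNIV gradV"
    and "0 < \<rho>"
    and drift: "\<And>u. gradV u \<bullet> h u \<le> - \<rho> * W u"
    and "0 < cV"
    and cV_bound: "\<And>u. cV \<noteq> \<infinity> \<Longrightarrow> ereal (norm (gradV u)) \<le> cV * ereal (sqrt (W u))"
    and small_bias: "cV * ereal (sqrt (\<tau> 0) / 2 + sqrt (\<tau> 1)) < ereal \<rho>"
    and step_sizes: "\<And>k. 1 \<le> k \<Longrightarrow> 0 < \<gamma> k \<and> ereal (\<gamma> k) < gamma_max cV \<rho> L \<sigma> \<tau> c"
    and "1 \<le> T"
  shows
    "let \<omega> = omega cV \<rho> L \<sigma> \<tau> c \<gamma>;
         S = (\<Sum>l<T. ereal (\<gamma> (l + 1)) * \<omega> (l + 1));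
         Vstar = (INF u. V u)
     in (\<Sum>k<T. ereal (\<gamma> (k + 1)) * \<omega> (k + 1) / S * ext_expectation M (\<lambda>p. W (w k p)))
        \<le> (2 * (ext_expectation M (\<lambda>p. V (w 0 p)) - ereal Vstar)
              + ereal (L * eta \<sigma> \<tau> c 0 * (\<Sum>k<T. (\<gamma> (k + 1))\<^sup>2))) / S
          + 2 * b0 cV \<tau> * ereal (\<Sum>k<T. \<gamma> (k + 1)) / S"
proof -
  interpret prob_space M by fact
  have c: "0 \<le> c 0" "0 \<le> c 1" "0 \<le> \<tau> 0" "0 \<le> \<tau> 1"
    using constants_nonneg[of 0] constants_nonneg[of 1] by auto
  obtain B0 B1 where B: "b0 cV \<tau> = ereal B0" "b1 cV \<tau> = ereal B1" "B1 < \<rho>"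
    and bias_work: "\<And>u e. (norm e)\<^sup>2 \<le> \<tau> 0 + \<tau> 1 * W u \<Longrightarrow> gradV u \<bullet> e \<le> B0 + B1 * W u"
  proof (rule small_bias_constants[where W = W and gradV = gradV and \<tau> = \<tau>, OF \<open>0 < cV\<close> c(3,4) assms(5) _ small_bias])
    show "cV = \<infinity> \<or> (\<forall>u. ereal (norm (gradV u)) \<le> cV * ereal (sqrt (W u)))"
      using cV_bound by blast
  qed blast
  define v where "v = (INF u. V u)"
  have lower: "v \<le> V u" for u
    unfolding v_def using V_bounded_below by (intro cINF_lower) auto
  define \<omega> where "\<omega> k = 2 * (\<rho> - B1) - \<gamma> k * L * eta \<sigma> \<tau> c 1" for k
  define S where "S = (\<Sum>l<T. \<gamma> (l + 1) * \<omega> (l + 1))"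
  have omega: "omega cV \<rho> L \<sigma> \<tau> c \<gamma> k = ereal (\<omega> k)" for k
    by (simp add: omega_def B \<omega>_def)
  have L0: "0 \<le> L" using gradV_lipschitz by (rule lipschitz_on_nonneg)
  have eta0: "0 \<le> eta \<sigma> \<tau> c 1" using c by (simp add: eta_def)
  have step: "0 < \<gamma> k" "0 < \<omega> k" if "1 \<le> k" for k
  proof -
    show "0 < \<gamma> k" using step_sizes[OF that] by simp
    show "0 < \<omega> k"
    proof (cases "L * eta \<sigma> \<tau> c 1 = 0")
      case True
      then have z: "\<gamma> k * L * eta \<sigma> \<tau> c 1 = 0" by simp
      show ?thesis using B(3) unfolding \<omega>_def z by simp
    next
      case False
      then have "0 < L * eta \<sigma> \<tau> c 1" using L0 eta0 by (simp add: less_le)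
      moreover have "\<gamma> k < 2 * (\<rho> - B1) / (L * eta \<sigma> \<tau> c 1)"
        using step_sizes[OF that] False by (simp add: gamma_max_def B)
      ultimately show ?thesis by (simp add: \<omega>_def field_simps)
    qed
  qed
  have S: "0 < S"
    unfolding S_def using step \<open>1 \<le> T\<close> by (intro sum_pos) (auto simp: lessThan_empty_iff)
  have S_ereal: "(\<Sum>l<T. ereal (\<gamma> (l + 1)) * omega cV \<rho> L \<sigma> \<tau> c \<gamma> (l + 1)) = ereal S"
    by (simp add: omega S_def)
  show ?thesis
  proof (cases "integrable M (\<lambda>p. V (w 0 p))")
    case False
    have "(\<lambda>p. V (w 0 p)) \<in> borel_measurable M"
      using borel_measurable_if_gradient[OF V_gradient] \<open>w 0 \<in> borel_measurable M\<close> by measurable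
    then have "ext_expectation M (\<lambda>p. V (w 0 p)) = \<infinity>"
      using False lower by (rule ext_expectation_not_integrable)
    then show ?thesis
      using S unfolding Let_def S_ereal by (simp add: B)
  next
    case True
    let ?F = "history M N (w 0) X" and ?G = "\<lambda>k p. H (w k p, X (Suc k) p)"
    have sub: "subalgebra M (?F k)" for k
      using assms(6,7) by (intro subalgebra_history) auto
    have wF: "w k \<in> borel_measurable (?F k)" for k
      by (rule iterate_measurable_history[where w = w and X = X and \<gamma> = \<gamma>, OF assms(3,6) recursion])
    have G: "?G k \<in> borel_measurable M" for k
    proof -
      have [measurable]: "w k \<in> borel_measurable M" "X (Suc k) \<in> measurable M N"
        using measurable_from_subalg[OF sub wF] assms(6)[of "Suc k"] by auto
      note assms(3)[measurable]
      show ?thesis by measurable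
    qed
    have descent: "integrable M (\<lambda>p. V (w (Suc k) p))"
      "integrable M (\<lambda>p. W (w k p))"
      "\<gamma> (Suc k) * \<omega> (Suc k) * (\<integral>p. W (w k p) \<partial>M)
         \<le> 2 * ((\<integral>p. V (w k p) \<partial>M) - (\<integral>p. V (w (Suc k) p) \<partial>M))
           + L * eta \<sigma> \<tau> c 0 * (\<gamma> (Suc k))\<^sup>2 + 2 * B0 * \<gamma> (Suc k)"
      if "integrable M (\<lambda>p. V (w k p))" for k
    proof -
      have eq: "integrable M (\<lambda>p. V (w (Suc k) p)) = integrable M (\<lambda>p. V (w k p + \<gamma> (Suc k) *\<^sub>R ?G k p))"
        "(\<integral>p. V (w (Suc k) p) \<partial>M) = (\<integral>p. V (w k p + \<gamma> (Suc k) *\<^sub>R ?G k p) \<partial>M)"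
        by (intro Bochner_Integration.integrable_cong Bochner_Integration.integral_cong refl;
            simp add: recursion)+
      have "0 \<le> \<gamma> (Suc k)" using step(1)[of "Suc k"] by simp
      note ed = expected_descent[where F = "?F k" and u = "w k" and G = "?G k" and V = V and W = W
          and g = gradV and h = h and a = "\<gamma> (Suc k)" and \<sigma> = \<sigma> and \<tau> = \<tau> and c = c, OF sub wF G oracle_L2 that this assms(2,4,5) c mean_field_bound
          oracle_bias oracle_variance V_gradient gradV_lipschitz lower \<open>0 < \<rho>\<close> drift bias_work]
      show "integrable M (\<lambda>p. V (w (Suc k) p))" unfolding eq by (rule ed(1))
      show "integrable M (\<lambda>p. W (w k p))" by (rule ed(2))
      show "\<gamma> (Suc k) * \<omega> (Suc k) * (\<integral>p. W (w k p) \<partial>M)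
         \<le> 2 * ((\<integral>p. V (w k p) \<partial>M) - (\<integral>p. V (w (Suc k) p) \<partial>M))
           + L * eta \<sigma> \<tau> c 0 * (\<gamma> (Suc k))\<^sup>2 + 2 * B0 * \<gamma> (Suc k)"
        unfolding eq \<omega>_def by (rule ed(3))
    qed
    have VI: "integrable M (\<lambda>p. V (w k p))" for k
      by (induction k) (auto intro: True descent(1))
    let ?EW = "\<lambda>k. \<integral>p. W (w k p) \<partial>M" and ?EV = "\<lambda>k. \<integral>p. V (w k p) \<partial>M"
    have "(\<Sum>k<T. \<gamma> (k + 1) * \<omega> (k + 1) * ?EW k)
        \<le> (\<Sum>k<T. 2 * (?EV k - ?EV (Suc k)) + L * eta \<sigma> \<tau> c 0 * (\<gamma> (k + 1))\<^sup>2 + 2 * B0 * \<gamma> (k + 1))"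
      using descent(3)[OF VI] by (intro sum_mono) simp
    also have "\<dots> = 2 * (\<Sum>k<T. ?EV k - ?EV (Suc k)) + L * eta \<sigma> \<tau> c 0 * (\<Sum>k<T. (\<gamma> (k + 1))\<^sup>2)
        + 2 * B0 * (\<Sum>k<T. \<gamma> (k + 1))"
      by (simp only: sum.distrib sum_distrib_left)
    also have "(\<Sum>k<T. ?EV k - ?EV (Suc k)) = ?EV 0 - ?EV T"
      by (rule sum_lessThan_telescope')
    finally have sum: "(\<Sum>k<T. \<gamma> (k + 1) * \<omega> (k + 1) * ?EW k)
        \<le> 2 * (?EV 0 - ?EV T) + L * eta \<sigma> \<tau> c 0 * (\<Sum>k<T. (\<gamma> (k + 1))\<^sup>2)
        + 2 * B0 * (\<Sum>k<T. \<gamma> (k + 1))" .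
    have low: "v \<le> ?EV T"
      using integral_mono[OF _ VI[of T], of "\<lambda>_. v"] lower by (simp add: prob_space)
    have "(\<Sum>k<T. \<gamma> (k + 1) * \<omega> (k + 1) * ?EW k)
        \<le> (2 * (?EV 0 - v) + L * eta \<sigma> \<tau> c 0 * (\<Sum>k<T. (\<gamma> (k + 1))\<^sup>2))
        + 2 * B0 * (\<Sum>k<T. \<gamma> (k + 1))"
      by (rule order_trans[OF sum]) (intro add_right_mono mult_left_mono diff_left_mono low; simp)
    then have "(\<Sum>k<T. \<gamma> (k + 1) * \<omega> (k + 1) * ?EW k) / S
        \<le> ((2 * (?EV 0 - v) + L * eta \<sigma> \<tau> c 0 * (\<Sum>k<T. (\<gamma> (k + 1))\<^sup>2))
        + 2 * B0 * (\<Sum>k<T. \<gamma> (k + 1))) / S"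
      using S by (intro divide_right_mono) auto
    then have final: "(\<Sum>k<T. \<gamma> (k + 1) * \<omega> (k + 1) / S * ?EW k)
        \<le> (2 * (?EV 0 - v) + L * eta \<sigma> \<tau> c 0 * (\<Sum>k<T. (\<gamma> (k + 1))\<^sup>2)) / S
        + 2 * B0 * (\<Sum>k<T. \<gamma> (k + 1)) / S"
      by (simp add: sum_divide_distrib add_divide_distrib)
    have "S \<noteq> 0" using S by simp
    have two: "2 * ereal r = ereal (2 * r)" for r
      by (metis times_ereal.simps(1) numeral_eq_ereal)
    show ?thesis
      unfolding Let_def S_ereal
      unfolding omega B ext_expectation_integrable[OF True]
        ext_expectation_integrable[OF descent(2)[OF VI]] v_def[symmetric]
      using final \<open>S \<noteq> 0\<close> by (simp add: two)
  qed
qed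

end
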